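(* Let $\Omega\subset\mathbb R^n$ be open. For $F\in C^\infty(\Omega;\mathbb M^{n\times n}_{\mathrm{sym}_0})$ define the fourth-order operator $\mathcal A: C^\infty(\Omega;\mathbb M^{n\times n}_{\mathrm{sym}_0})\to C^\infty(\Omega;\mathbb M^{n\times n}_{\mathrm{sym}_0})$ by $$(\mathcal A(F))_{jk}:=\sum_{i,\ell=1}^n\big(\partial_{iij\ell}F_{k\ell}+\partial_{iik\ell}F_{\ell j}\big)-\sum_{i,\ell=1}^n\partial_{ii\ell\ell}F_{jk}-\frac{n-2}{n-1}\sum_{i,\ell=1}^n\partial_{i\ell jk}F_{i\ell}-\frac{\delta_{jk}}{n-1}\sum_{i,\ell,m=1}^n\partial_{ii\ell m}F_{\ell m}.$$ Then for every $u\in C^\infty(\mathbb R^n;\mathbb R^n)$ it holds $\mathcal A(\mathcal E_d u)=0$.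
   Context: $n\ge2$; $\mathbb M^{n\times n}_{\mathrm{sym}_0}$ is the space of real symmetric trace-free $n\times n$ matrices; $\mathcal E_d u:=\frac{\nabla u+\nabla u^t}{2}-\frac{\mathrm{div}(u)}{n}\mathrm{Id}$; $\partial_{ijk\ell}$ denotes the fourth-order partial derivative and $\delta_{jk}$ the Kronecker delta. *)

theory Defs
  imports "HOL-Analysis.Analysis"
begin

text \<open>All differential operators below act on total functions. They are only evaluated at points
  of an open set, where their values depend only on the values of the function on that set.\<close>

text \<open>Meaningful only for open \<open>S\<close>, since differentiability is required at \<open>x\<close> and not
  merely within \<open>S\<close>.\<close>

primrec Ck_on :: "nat \<Rightarrow> 'a::euclidean_space set \<Rightarrow> ('a \<Rightarrow> 'b::real_normed_vector) \<Rightarrow> bool" where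
  "Ck_on 0 S f \<longleftrightarrow> continuous_on S f"
| "Ck_on (Suc k) S f \<longleftrightarrow>
     (\<forall>x\<in>S. f differentiable (at x)) \<and> (\<forall>v. Ck_on k S (\<lambda>x. frechet_derivative f (at x) v))"

definition Cinf :: "'a::euclidean_space set \<Rightarrow> 'b::real_normed_vector set \<Rightarrow> ('a \<Rightarrow> 'b) set" where
  "Cinf S V = {f. (\<forall>k. Ck_on k S f) \<and> (\<forall>x\<in>S. f x \<in> V)}"

definition sym0 :: "(real^'n^'n) set" where
  "sym0 = {M. transpose M = M \<and> trace M = 0}"

definition pd :: "'n::finite \<Rightarrow> (real^'n \<Rightarrow> real) \<Rightarrow> real^'n \<Rightarrow> real" where
  "pd i f x = deriv (\<lambda>t. f (x + t *\<^sub>R axis i 1)) 0"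

definition pd4 :: "'n::finite \<Rightarrow> 'n \<Rightarrow> 'n \<Rightarrow> 'n \<Rightarrow> (real^'n \<Rightarrow> real) \<Rightarrow> real^'n \<Rightarrow> real" where
  "pd4 i j k l f = pd i (pd j (pd k (pd l f)))"

definition divergence :: "(real^'n \<Rightarrow> real^'n) \<Rightarrow> real^'n \<Rightarrow> real" where
  "divergence u x = (\<Sum>i\<in>UNIV. pd i (\<lambda>y. u y $ i) x)"

definition dev_sym_grad :: "(real^'n \<Rightarrow> real^'n) \<Rightarrow> real^'n \<Rightarrow> real^'n^'n" where
  "dev_sym_grad u x =
     (1/2) *\<^sub>R (jacobian u (at x) + transpose (jacobian u (at x)))
     - (divergence u x / real CARD('n)) *\<^sub>R mat 1"

definition op_A :: "(real^'n \<Rightarrow> real^'n^'n) \<Rightarrow> real^'n \<Rightarrow> real^'n^'n" where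
  "op_A F x = (\<chi> j k.
     (\<Sum>i\<in>UNIV. \<Sum>l\<in>UNIV. pd4 i i j l (\<lambda>y. F y $ k $ l) x + pd4 i i k l (\<lambda>y. F y $ l $ j) x)
     - (\<Sum>i\<in>UNIV. \<Sum>l\<in>UNIV. pd4 i i l l (\<lambda>y. F y $ j $ k) x)
     - (real CARD('n) - 2) / (real CARD('n) - 1)
         * (\<Sum>i\<in>UNIV. \<Sum>l\<in>UNIV. pd4 i l j k (\<lambda>y. F y $ i $ l) x)
     - (if j = k then 1 else 0) / (real CARD('n) - 1)
         * (\<Sum>i\<in>UNIV. \<Sum>l\<in>UNIV. \<Sum>m\<in>UNIV. pd4 i i l m (\<lambda>y. F y $ l $ m) x))"

end

theory Submission
  imports Defs
begin

text \<open>By Clairaut's theorem all partial derivatives of a smooth function commute. The trace of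
  \<open>op_A F\<close> is then \<open>2 - (n - 2)/(n - 1) - n/(n - 1) = 0\<close> times the Laplacian of the double
  divergence of \<open>F\<close>. For \<open>F = dev_sym_grad u\<close>, every contraction in \<open>op_A F\<close> reduces to one of
  the expressions \<open>H j k\<close> (bilaplacian of \<open>\<partial>\<^sub>j u\<^sub>k\<close>), \<open>G j k\<close> (\<open>\<partial>\<^sub>j\<partial>\<^sub>k\<close> of the Laplacian of the
  divergence of \<open>u\<close>) and \<open>K\<close> (bilaplacian of the divergence), and their coefficients cancel.\<close>

section \<open>Closure properties of \<open>Ck_on\<close> and \<open>Cinf\<close>\<close>

text \<open>On an open set, agreement on \<open>S\<close> is agreement near each of its points, so
  the derivatives agree as well and the induction passes to them. The closure lemmas below need this
  because their derivative formulas are only known on \<open>S\<close>.\<close>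

lemma Ck_on_cong:
  assumes "open S" "\<And>x. x \<in> S \<Longrightarrow> f x = g x" "Ck_on k S f"
  shows "Ck_on k S g"
  using assms(2,3)
proof (induction k arbitrary: f g)
  case 0
  then show ?case by (simp cong: continuous_on_cong)
next
  case (Suc k)
  have eq: "frechet_derivative f (at x) = frechet_derivative g (at x)" if "x \<in> S" for x
    using frechet_derivative_transform_within_open[OF _ assms(1) that] Suc.prems that by auto
  have "g differentiable at x" if "x \<in> S" for x
    using Suc.prems that assms(1)
    by (meson Ck_on.simps(2) differentiable_def has_derivative_transform_within_open)
  moreover have "Ck_on k S (\<lambda>x. frechet_derivative g (at x) v)" for v
    using Suc.IH[of "\<lambda>x. frechet_derivative f (at x) v" "\<lambda>x. frechet_derivative g (at x) v"]
      eq Suc.prems by auto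
  ultimately show ?case by simp
qed

lemma Ck_on_subset: "Ck_on k T f \<Longrightarrow> S \<subseteq> T \<Longrightarrow> Ck_on k S f"
  by (induction k arbitrary: f) (auto intro: continuous_on_subset)

lemma Ck_on_bounded_linear:
  assumes "open S" "bounded_linear h" "Ck_on k S f"
  shows "Ck_on k S (\<lambda>x. h (f x))"
  using assms(3)
proof (induction k arbitrary: f)
  case 0
  then show ?case using bounded_linear.continuous_on[OF assms(2)] by auto
next
  case (Suc k)
  have hd: "((\<lambda>x. h (f x)) has_derivative (\<lambda>v. h (frechet_derivative f (at x) v))) (at x)"
    if "x \<in> S" for x
    using Suc.prems that
    by (auto intro!: bounded_linear.has_derivative[OF assms(2)] simp: frechet_derivative_works[symmetric])
  have "Ck_on k S (\<lambda>x. frechet_derivative (\<lambda>x. h (f x)) (at x) v)" for v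
    by (rule Ck_on_cong[OF assms(1) _ Suc.IH[of "\<lambda>x. frechet_derivative f (at x) v"]])
      (use Suc.prems frechet_derivative_at[OF hd] in \<open>auto dest: fun_cong\<close>)
  with hd show ?case by (auto simp: differentiable_def)
qed

lemma Ck_on_add:
  assumes "open S" "Ck_on k S f" "Ck_on k S g"
  shows "Ck_on k S (\<lambda>x. f x + g x)"
  using assms(2,3)
proof (induction k arbitrary: f g)
  case 0
  then show ?case by (auto intro: continuous_on_add)
next
  case (Suc k)
  have hd: "((\<lambda>x. f x + g x) has_derivative
      (\<lambda>v. frechet_derivative f (at x) v + frechet_derivative g (at x) v)) (at x)"
    if "x \<in> S" for x
    using Suc.prems that by (auto intro!: has_derivative_add simp: frechet_derivative_works[symmetric])
  have "Ck_on k S (\<lambda>x. frechet_derivative (\<lambda>x. f x + g x) (at x) v)" for v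
    by (rule Ck_on_cong[OF assms(1) _ Suc.IH[of "\<lambda>x. frechet_derivative f (at x) v"
            "\<lambda>x. frechet_derivative g (at x) v"]])
      (use Suc.prems frechet_derivative_at[OF hd] in \<open>auto dest: fun_cong\<close>)
  with hd show ?case by (auto simp: differentiable_def)
qed

lemma Ck_on_zero: "Ck_on k S (\<lambda>x. 0)"
  by (induction k) auto

text \<open>Removes the order \<open>k\<close>: later arguments pass from a smooth function to its
  directional derivatives without counting orders. In the backward direction \<open>k = 0\<close>
  stands apart, since there only continuity is asked and differentiability supplies it.\<close>

lemma Cinf_derivative_iff:
  "f \<in> Cinf S UNIV \<longleftrightarrow> (\<forall>x\<in>S. f differentiable (at x)) \<and>
    (\<forall>v. (\<lambda>x. frechet_derivative f (at x) v) \<in> Cinf S UNIV)" (is "?L \<longleftrightarrow> ?R")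
proof
  assume ?L
  then have "Ck_on (Suc k) S f" for k by (simp add: Cinf_def del: Ck_on.simps)
  then show ?R by (auto simp: Cinf_def)
next
  assume R: ?R
  have "Ck_on k S f" for k
  proof (cases k)
    case 0
    with R show ?thesis
      by (auto intro!: differentiable_imp_continuous_on
          simp: differentiable_on_def differentiable_at_withinI)
  next
    case (Suc m)
    with R show ?thesis by (auto simp: Cinf_def)
  qed
  then show ?L by (simp add: Cinf_def)
qed

text \<open>Separates the constraint on values, so that all calculus runs with target
  \<open>UNIV\<close> and membership in \<open>sym0\<close> is checked pointwise.\<close>

lemma Cinf_iff: "f \<in> Cinf S V \<longleftrightarrow> f \<in> Cinf S UNIV \<and> (\<forall>x\<in>S. f x \<in> V)"
  by (auto simp: Cinf_def)

lemma Cinf_cong: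
  "open S \<Longrightarrow> (\<And>x. x \<in> S \<Longrightarrow> f x = g x) \<Longrightarrow> f \<in> Cinf S UNIV \<Longrightarrow> g \<in> Cinf S UNIV"
  unfolding Cinf_def using Ck_on_cong[of S f g] by auto

lemma Cinf_subset: "f \<in> Cinf T UNIV \<Longrightarrow> S \<subseteq> T \<Longrightarrow> f \<in> Cinf S UNIV"
  by (auto simp: Cinf_def intro: Ck_on_subset)

lemma Cinf_bounded_linear:
  "open S \<Longrightarrow> bounded_linear h \<Longrightarrow> f \<in> Cinf S UNIV \<Longrightarrow> (\<lambda>x. h (f x)) \<in> Cinf S UNIV"
  by (auto simp: Cinf_def intro: Ck_on_bounded_linear)

lemma Cinf_add:
  "open S \<Longrightarrow> f \<in> Cinf S UNIV \<Longrightarrow> g \<in> Cinf S UNIV \<Longrightarrow> (\<lambda>x. f x + g x) \<in> Cinf S UNIV"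
  by (auto simp: Cinf_def intro: Ck_on_add)

lemma Cinf_cmult:
  fixes f :: "_ \<Rightarrow> real"
  shows "open S \<Longrightarrow> f \<in> Cinf S UNIV \<Longrightarrow> (\<lambda>x. c * f x) \<in> Cinf S UNIV"
  by (rule Cinf_bounded_linear[OF _ bounded_linear_mult_right])

lemma Cinf_minus:
  "open S \<Longrightarrow> f \<in> Cinf S UNIV \<Longrightarrow> g \<in> Cinf S UNIV \<Longrightarrow> (\<lambda>x. f x - g x) \<in> Cinf S UNIV"
  using Cinf_add[of S f "\<lambda>x. - g x"]
    Cinf_bounded_linear[OF _ bounded_linear_minus[OF bounded_linear_ident], of S g]
  by simp

lemma Cinf_sum:
  assumes "open S" "\<And>a. a \<in> A \<Longrightarrow> f a \<in> Cinf S UNIV"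
  shows "(\<lambda>x. \<Sum>a\<in>A. f a x) \<in> Cinf S UNIV"
  using assms(2)
proof (induction A rule: infinite_finite_induct)
  case (insert a A)
  then show ?case using Cinf_add[OF assms(1), of "f a"] by auto
qed (auto simp: Cinf_def Ck_on_zero)

lemma Cinf_nth: "open S \<Longrightarrow> f \<in> Cinf S UNIV \<Longrightarrow> (\<lambda>x. f x $ i) \<in> Cinf S UNIV"
  by (rule Cinf_bounded_linear[OF _ bounded_linear_vec_nth])

lemma bounded_linear_axis: "bounded_linear (axis i)"
  by (rule bounded_linear_intro[where K = 1])
    (auto simp: vec_eq_iff axis_def norm_vec_def L2_set_def if_distrib[of norm]
      if_distrib[of "\<lambda>x. x\<^sup>2"] cong: if_cong)

text \<open>A vector is the finite sum of its components embedded by the bounded linear maps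
  \<open>axis i\<close>, so closure under sums and bounded linear maps suffices.\<close>

lemma Cinf_vecI:
  fixes f :: "'a::euclidean_space \<Rightarrow> 'b::real_normed_vector ^ 'm"
  assumes "open S" "\<And>i. (\<lambda>x. f x $ i) \<in> Cinf S UNIV"
  shows "f \<in> Cinf S UNIV"
proof -
  have "f = (\<lambda>x. \<Sum>i\<in>UNIV. axis i (f x $ i))"
    by (auto simp: vec_eq_iff axis_def)
  then show ?thesis
    using Cinf_sum[OF assms(1), of UNIV "\<lambda>i x. axis i (f x $ i)"]
      Cinf_bounded_linear[OF assms(1) bounded_linear_axis assms(2)] by metis
qed

section \<open>Symmetry of second derivatives\<close>

text \<open>The chain rule along a line links the Frechet derivative to one-variable derivatives, as
  needed for the mean value theorem and for \<open>pd\<close>.\<close>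

lemma Cinf_lineD:
  fixes f :: "'a::euclidean_space \<Rightarrow> real"
  assumes "f \<in> Cinf S UNIV" "z + t *\<^sub>R v \<in> S"
  shows "((\<lambda>t. f (z + t *\<^sub>R v)) has_real_derivative
           frechet_derivative f (at (z + t *\<^sub>R v)) v) (at t)"
proof -
  have f: "(f has_derivative frechet_derivative f (at (z + t *\<^sub>R v))) (at (z + t *\<^sub>R v))"
    using assms Cinf_derivative_iff frechet_derivative_works by blast
  have "((\<lambda>t. z + t *\<^sub>R v) has_derivative (\<lambda>s. s *\<^sub>R v)) (at t)"
    by (auto intro!: derivative_eq_intros)
  from has_derivative_compose[OF this f]
  show ?thesis
    by (auto simp: has_field_derivative_def linear_cmul[OF has_derivative_linear[OF f]]
        mult.commute[of _ "frechet_derivative f _ v"] elim!: has_derivative_eq_rhs)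
qed

text \<open>Swapping \<open>v\<close> and \<open>w\<close> leaves the second difference unchanged, which yields Clairaut's
  theorem as \<open>h\<close> tends to 0.\<close>

lemma second_difference:
  fixes f :: "'a::euclidean_space \<Rightarrow> real"
  assumes f: "f \<in> Cinf S UNIV" and h: "0 < h"
    and S: "\<And>s t. 0 \<le> s \<Longrightarrow> s \<le> h \<Longrightarrow> 0 \<le> t \<Longrightarrow> t \<le> h \<Longrightarrow> x + s *\<^sub>R v + t *\<^sub>R w \<in> S"
  obtains a b where "0 < a" "a < h" "0 < b" "b < h"
    "f (x + h *\<^sub>R v + h *\<^sub>R w) - f (x + h *\<^sub>R v) - f (x + h *\<^sub>R w) + f x =
      h * h * frechet_derivative (\<lambda>y. frechet_derivative f (at y) v) (at (x + a *\<^sub>R v + b *\<^sub>R w)) w"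
proof -
  \<comment> \<open>The mean value theorem is applied twice: first along \<open>v\<close> to the
    difference \<open>?g\<close> of \<open>f\<close> on two parallel segments, then along
    \<open>w\<close> to \<open>?f'\<close> at the point found.\<close>
  let ?g = "\<lambda>s. f ((x + h *\<^sub>R w) + s *\<^sub>R v) - f (x + s *\<^sub>R v)"
  let ?f' = "\<lambda>y. frechet_derivative f (at y) v"
  have f': "?f' \<in> Cinf S UNIV" using f Cinf_derivative_iff by blast
  have "(?g has_real_derivative (?f' ((x + h *\<^sub>R w) + s *\<^sub>R v) - ?f' (x + s *\<^sub>R v))) (at s)"
    if "0 \<le> s" "s \<le> h" for s
    using S[OF that, of 0] S[OF that, of h] h
    by (intro DERIV_diff Cinf_lineD[OF f]) (auto simp: algebra_simps)
  from MVT2[OF h this] obtain a where a: "0 < a" "a < h"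
    "?g h - ?g 0 = h * (?f' ((x + h *\<^sub>R w) + a *\<^sub>R v) - ?f' (x + a *\<^sub>R v))" by auto
  have "((\<lambda>t. ?f' ((x + a *\<^sub>R v) + t *\<^sub>R w)) has_real_derivative
      frechet_derivative ?f' (at ((x + a *\<^sub>R v) + t *\<^sub>R w)) w) (at t)"
    if "0 \<le> t" "t \<le> h" for t
    using S[of a t] that a by (intro Cinf_lineD[OF f']) auto
  from MVT2[OF h this] obtain b where b: "0 < b" "b < h"
    "?f' ((x + a *\<^sub>R v) + h *\<^sub>R w) - ?f' ((x + a *\<^sub>R v) + 0 *\<^sub>R w) =
      h * frechet_derivative ?f' (at ((x + a *\<^sub>R v) + b *\<^sub>R w)) w" by auto
  show ?thesis
    by (rule that[OF a(1,2) b(1,2)]) (use a(3) b(3) in \<open>simp add: algebra_simps\<close>)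
qed

lemma frechet_derivative_commute:
  fixes f :: "'a::euclidean_space \<Rightarrow> real"
  assumes S: "open S" and f: "f \<in> Cinf S UNIV" and x: "x \<in> S"
  shows "frechet_derivative (\<lambda>y. frechet_derivative f (at y) v) (at x) w =
    frechet_derivative (\<lambda>y. frechet_derivative f (at y) w) (at x) v"
proof -
  define D where "D v w y = frechet_derivative (\<lambda>y. frechet_derivative f (at y) v) (at y) w" for v w y
  have "D v w \<in> Cinf S UNIV" for v w
    unfolding D_def using f Cinf_derivative_iff by blast
  then have cont: "isCont (D v w) x" for v w
    using Cinf_derivative_iff x differentiable_imp_continuous_within by blast
  \<comment> \<open>At a small scale \<open>h\<close> both mixed derivatives equal the second
    difference divided by \<open>h * h\<close>, each at its own point near \<open>x\<close>. By
    continuity each of these values is within \<open>e / 2\<close> of the value at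
    \<open>x\<close>.\<close>
  have "\<bar>D v w x - D w v x\<bar> \<le> e" if e: "e > 0" for e
  proof -
    have "\<exists>d>0. \<forall>y. dist y x < d \<longrightarrow> dist (D v w y) (D v w x) < e / 2" for v w
      using cont[of v w] e unfolding continuous_at_eps_delta by (metis half_gt_zero dist_commute)
    then obtain d1 d2 where d: "d1 > 0" "d2 > 0"
      "\<And>y. dist y x < d1 \<Longrightarrow> dist (D v w y) (D v w x) < e / 2"
      "\<And>y. dist y x < d2 \<Longrightarrow> dist (D w v y) (D w v x) < e / 2" by metis
    obtain d3 where d3: "d3 > 0" "ball x d3 \<subseteq> S" using S x openE by blast
    define r where "r = min d1 (min d2 d3)"
    have r: "r > 0" "r \<le> d1" "r \<le> d2" "r \<le> d3" using d d3 by (auto simp: r_def)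
    \<comment> \<open>This choice keeps the parallelogram spanned by \<open>h *\<^sub>R v\<close>
      and \<open>h *\<^sub>R w\<close> within \<open>r / 2\<close> of \<open>x\<close>; the added 1
      keeps the denominator positive when \<open>v\<close> and \<open>w\<close> both vanish.\<close>
    define h where "h = r / (2 * (norm v + norm w + 1))"
    have n: "norm v + norm w + 1 > 0" by (simp add: add_nonneg_pos)
    have h: "h > 0" using r n by (simp add: h_def)
    have dist: "dist (x + s *\<^sub>R v + t *\<^sub>R w) x < r" if "0 \<le> s" "s \<le> h" "0 \<le> t" "t \<le> h" for s t
    proof -
      have "dist (x + s *\<^sub>R v + t *\<^sub>R w) x = norm (s *\<^sub>R v + t *\<^sub>R w)"
        by (simp add: dist_norm add.assoc)
      also have "\<dots> \<le> s * norm v + t * norm w"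
        using norm_triangle_ineq[of "s *\<^sub>R v" "t *\<^sub>R w"] that by simp
      also have "\<dots> \<le> h * norm v + h * norm w"
        using that by (intro add_mono mult_right_mono) auto
      also have "\<dots> \<le> h * (norm v + norm w + 1)" using h by (simp add: algebra_simps)
      also have "\<dots> = r / 2" using n by (simp add: h_def field_simps)
      also have "\<dots> < r" using r by simp
      finally show ?thesis .
    qed
    have inS: "x + s *\<^sub>R v + t *\<^sub>R w \<in> S" if "0 \<le> s" "s \<le> h" "0 \<le> t" "t \<le> h" for s t
      using dist[OF that] d3 r by (auto simp: subset_iff dist_commute)
    obtain a b where ab: "0 < a" "a < h" "0 < b" "b < h"
      "f (x + h *\<^sub>R v + h *\<^sub>R w) - f (x + h *\<^sub>R v) - f (x + h *\<^sub>R w) + f x =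
        h * h * D v w (x + a *\<^sub>R v + b *\<^sub>R w)"
      using second_difference[OF f h inS] unfolding D_def by blast
    have "x + s *\<^sub>R w + t *\<^sub>R v \<in> S" if "0 \<le> s" "s \<le> h" "0 \<le> t" "t \<le> h" for s t
      using inS[of t s] that by (simp add: algebra_simps)
    from second_difference[OF f h this] obtain a' b' where ab': "0 < a'" "a' < h" "0 < b'" "b' < h"
      "f (x + h *\<^sub>R w + h *\<^sub>R v) - f (x + h *\<^sub>R w) - f (x + h *\<^sub>R v) + f x =
        h * h * D w v (x + a' *\<^sub>R w + b' *\<^sub>R v)"
      unfolding D_def by blast
    have "h * h * D v w (x + a *\<^sub>R v + b *\<^sub>R w) = h * h * D w v (x + a' *\<^sub>R w + b' *\<^sub>R v)"
      using ab(5) ab'(5) by (simp add: algebra_simps)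
    \<comment> \<open>The second point is rewritten with its \<open>v\<close> part first, so that
      \<open>dist\<close> applies to it with \<open>b'\<close> and \<open>a'\<close>
      exchanged.\<close>
    then have eq: "D v w (x + a *\<^sub>R v + b *\<^sub>R w) = D w v (x + b' *\<^sub>R v + a' *\<^sub>R w)"
      using h by (simp add: algebra_simps)
    have "dist (D v w (x + a *\<^sub>R v + b *\<^sub>R w)) (D v w x) < e / 2"
      using dist[of a b] ab r by (intro d(3)) auto
    moreover have "dist (D w v (x + b' *\<^sub>R v + a' *\<^sub>R w)) (D w v x) < e / 2"
      using dist[of b' a'] ab' r by (intro d(4)) auto
    ultimately show ?thesis
      unfolding eq dist_real_def by linarith
  qed
  then have "\<bar>D v w x - D w v x\<bar> \<le> 0" by (rule field_le_epsilon) simp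
  then show ?thesis by (simp add: D_def)
qed

section \<open>Calculus of \<open>pd\<close> and \<open>pd4\<close> on smooth functions\<close>

lemma pd_eq_frechet_derivative:
  assumes "f \<in> Cinf S UNIV" "x \<in> S"
  shows "pd i f x = frechet_derivative f (at x) (axis i 1)"
  unfolding pd_def using Cinf_lineD[OF assms(1), of x 0 "axis i 1"] assms(2)
  by (auto intro: DERIV_imp_deriv)

lemma Cinf_pd: "open S \<Longrightarrow> f \<in> Cinf S UNIV \<Longrightarrow> pd i f \<in> Cinf S UNIV"
  by (rule Cinf_cong[of S "\<lambda>x. frechet_derivative f (at x) (axis i 1)"])
    (auto simp: pd_eq_frechet_derivative Cinf_derivative_iff[of f])

text \<open>Only a short segment through \<open>x\<close> matters for \<open>pd\<close> at
  \<open>x\<close>, and for small \<open>t\<close> it stays inside the open set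
  \<open>S\<close>.\<close>

lemma pd_cong:
  assumes "open S" "\<And>y. y \<in> S \<Longrightarrow> f y = g y" "x \<in> S"
  shows "pd i f x = pd i g x"
proof -
  have "\<forall>\<^sub>F y in nhds x. f y = g y"
    using assms eventually_nhds by blast
  moreover have "((\<lambda>t. x + t *\<^sub>R axis i 1) \<longlongrightarrow> x) (nhds (0::real))"
    by (rule tendsto_eq_intros tendsto_ident_at refl filterlim_ident | simp)+
  ultimately have "\<forall>\<^sub>F t in nhds 0. f (x + t *\<^sub>R axis i 1) = g (x + t *\<^sub>R axis i 1)"
    by (rule eventually_compose_filterlim)
  then show ?thesis unfolding pd_def by (rule deriv_cong_ev) simp
qed

lemma pd_commute:
  assumes "open S" "f \<in> Cinf S UNIV" "x \<in> S"
  shows "pd i (pd j f) x = pd j (pd i f) x"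
proof -
  have D: "(\<lambda>y. frechet_derivative f (at y) v) \<in> Cinf S UNIV" for v
    using assms Cinf_derivative_iff by blast
  have "pd i (pd j f) x = frechet_derivative (\<lambda>y. frechet_derivative f (at y) (axis j 1)) (at x) (axis i 1)" for i j
    using pd_cong[OF assms(1) pd_eq_frechet_derivative[OF assms(2)] assms(3)]
      pd_eq_frechet_derivative[OF D assms(3)] by simp
  then show ?thesis using frechet_derivative_commute[OF assms] by simp
qed


text \<open>The sum is a premise about \<open>h\<close> on \<open>S\<close> instead of a literal
  term. The rule can then be iterated through nested \<open>pd\<close>, where the inner derivative
  is known to split only at points of \<open>S\<close>.\<close>

lemma pd_add:
  assumes S: "open S" "f \<in> Cinf S UNIV" "g \<in> Cinf S UNIV" "x \<in> S"
    and h: "\<And>y. y \<in> S \<Longrightarrow> h y = f y + g y"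
  shows "pd i h x = pd i f x + pd i g x"
proof -
  have "pd i h x = pd i (\<lambda>y. f y + g y) x"
    by (rule pd_cong[OF S(1) h S(4)])
  also have "\<dots> = pd i f x + pd i g x"
    unfolding pd_def
    using Cinf_lineD[OF S(2), of x 0 "axis i 1"] Cinf_lineD[OF S(3), of x 0 "axis i 1"] S(4)
    by (intro deriv_add) (auto simp: field_differentiable_def)
  finally show ?thesis .
qed

lemma pd_cmult:
  assumes S: "open S" "f \<in> Cinf S UNIV" "x \<in> S"
    and h: "\<And>y. y \<in> S \<Longrightarrow> h y = c * f y"
  shows "pd i h x = c * pd i f x"
proof -
  have "pd i h x = pd i (\<lambda>y. c * f y) x"
    by (rule pd_cong[OF S(1) h S(3)])
  also have "\<dots> = c * pd i f x"
    unfolding pd_def using Cinf_lineD[OF S(2), of x 0 "axis i 1"] S(3)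
    by (intro deriv_cmult) (auto simp: field_differentiable_def)
  finally show ?thesis .
qed

lemma pd_zero: "pd i (\<lambda>y. 0) x = 0"
  by (simp add: pd_def)

lemma pd4_cong:
  assumes S: "open S" "\<And>y. y \<in> S \<Longrightarrow> f y = g y" "x \<in> S"
  shows "pd4 i j k l f x = pd4 i j k l g x"
  unfolding pd4_def by (intro pd_cong[OF S(1)] S)

lemma Cinf_pd4: "open S \<Longrightarrow> f \<in> Cinf S UNIV \<Longrightarrow> pd4 i j k l f \<in> Cinf S UNIV"
  unfolding pd4_def by (intro Cinf_pd)

lemma pd4_add:
  assumes S: "open S" "f \<in> Cinf S UNIV" "g \<in> Cinf S UNIV" "x \<in> S"
  shows "pd4 i j k l (\<lambda>y. f y + g y) x = pd4 i j k l f x + pd4 i j k l g x"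
  unfolding pd4_def by (intro pd_add[OF S(1)] Cinf_pd S refl)

lemma pd4_cmult:
  assumes S: "open S" "f \<in> Cinf S UNIV" "x \<in> S"
  shows "pd4 i j k l (\<lambda>y. c * f y) x = c * pd4 i j k l f x"
  unfolding pd4_def by (intro pd_cmult[OF S(1)] Cinf_pd S refl)

lemma pd4_zero: "pd4 i j k l (\<lambda>y. 0) x = 0"
  by (simp add: pd4_def pd_zero[abs_def])

lemma pd4_sum:
  assumes S: "open S" "\<And>a. a \<in> A \<Longrightarrow> f a \<in> Cinf S UNIV" "x \<in> S"
  shows "pd4 i j k l (\<lambda>y. \<Sum>a\<in>A. f a y) x = (\<Sum>a\<in>A. pd4 i j k l (f a) x)"
  using S(2)
proof (induction A rule: infinite_finite_induct)
  case (insert a A)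
  then show ?case
    using pd4_add[OF S(1), of "f a" "\<lambda>y. \<Sum>a\<in>A. f a y"] Cinf_sum[OF S(1), of A f] S(3) by simp
qed (auto simp: pd4_zero)

text \<open>These adjacent transpositions generate all permutations of the four indices; as
  permutative simp rules they bring index lists into a common order.\<close>

lemma pd4_swap:
  assumes S: "open S" "f \<in> Cinf S UNIV" "x \<in> S"
  shows "pd4 i j k l f x = pd4 j i k l f x"
    and "pd4 i j k l f x = pd4 i k j l f x"
    and "pd4 i j k l f x = pd4 i j l k f x"
proof -
  show "pd4 i j k l f x = pd4 j i k l f x"
    unfolding pd4_def by (intro pd_commute[OF S(1)] Cinf_pd S)
  show "pd4 i j k l f x = pd4 i k j l f x"
    unfolding pd4_def by (intro pd_cong[OF S(1)] pd_commute[OF S(1)] Cinf_pd S)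
  show "pd4 i j k l f x = pd4 i j l k f x"
    unfolding pd4_def by (intro pd_cong[OF S(1)] pd_commute[OF S(1)] Cinf_pd S)
qed

text \<open>Together with \<open>pd4_swap\<close> this makes all five derivatives interchangeable,
  which is needed because \<open>dev_sym_grad u\<close> already contains one derivative of
  \<open>u\<close>.\<close>

lemma pd4_pd_swap:
  assumes S: "open S" "f \<in> Cinf S UNIV" "x \<in> S"
  shows "pd4 i j k l (pd m f) x = pd4 i j k m (pd l f) x"
  unfolding pd4_def by (intro pd_cong[OF S(1)] pd_commute[OF S(1)] Cinf_pd S)

section \<open>\<open>op_A\<close> preserves smooth symmetric trace-free fields\<close>

lemma op_A_smooth:
  fixes F :: "real^'n \<Rightarrow> real^'n^'n"
  assumes S: "open S" and F: "F \<in> Cinf S UNIV"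
  shows "op_A F \<in> Cinf S UNIV"
proof (intro Cinf_vecI[OF S])
  fix j k
  have "(\<lambda>y. F y $ a $ b) \<in> Cinf S UNIV" for a b
    by (intro Cinf_nth S F)
  note D = Cinf_pd4[OF S this]
  show "(\<lambda>x. op_A F x $ j $ k) \<in> Cinf S UNIV"
    unfolding op_A_def vec_lambda_beta
    by (intro Cinf_minus Cinf_add Cinf_sum Cinf_cmult S D)
qed

lemma op_A_sym0:
  fixes F :: "real^'n \<Rightarrow> real^'n^'n"
  assumes n: "CARD('n) \<ge> 2" and S: "open S" and F: "F \<in> Cinf S sym0" and x: "x \<in> S"
  shows "op_A F x \<in> sym0"
proof -
  have FS: "(\<lambda>y. F y $ a $ b) \<in> Cinf S UNIV" for a b
    using F by (intro Cinf_nth S) (simp add: Cinf_iff[of F S sym0])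
  \<comment> \<open>The point \<open>x\<close> is fixed: the first four indices of \<open>Q\<close>
    are derivatives, the last two a matrix entry.\<close>
  define Q where "Q a b c d k l = pd4 a b c d (\<lambda>y. F y $ k $ l) x" for a b c d k l
  note sw = pd4_swap[OF S FS x, folded Q_def]
  have tr: "transpose (F y) = F y" "trace (F y) = 0" if "y \<in> S" for y
    using F that by (auto simp: Cinf_def sym0_def)
  have "F y $ k $ l = F y $ l $ k" if "y \<in> S" for y k l
    using tr(1)[OF that] by (simp add: transpose_def vec_eq_iff)
  then have Qs: "Q a b c d k l = Q a b c d l k" for a b c d k l
    unfolding Q_def by (rule pd4_cong[OF S _ x])
  have Qt: "(\<Sum>j\<in>UNIV. Q a b c d j j) = 0" for a b c d
  proof -
    have "(\<Sum>j\<in>UNIV. Q a b c d j j) = pd4 a b c d (\<lambda>y. \<Sum>j\<in>UNIV. F y $ j $ j) x"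
      unfolding Q_def by (rule pd4_sum[symmetric, OF S FS x])
    also have "\<dots> = pd4 a b c d (\<lambda>y. 0) x"
      by (rule pd4_cong[OF S _ x]) (use tr(2) in \<open>simp add: trace_def\<close>)
    finally show ?thesis by (simp add: pd4_zero)
  qed
  have A: "op_A F x $ j $ k =
     (\<Sum>i\<in>UNIV. \<Sum>l\<in>UNIV. Q i i j l k l + Q i i k l l j)
     - (\<Sum>i\<in>UNIV. \<Sum>l\<in>UNIV. Q i i l l j k)
     - (real CARD('n) - 2) / (real CARD('n) - 1) * (\<Sum>i\<in>UNIV. \<Sum>l\<in>UNIV. Q i l j k i l)
     - (if j = k then 1 else 0) / (real CARD('n) - 1)
         * (\<Sum>i\<in>UNIV. \<Sum>l\<in>UNIV. \<Sum>m\<in>UNIV. Q i i l m l m)" for j k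
    by (simp add: op_A_def Q_def)
  have "op_A F x $ j $ k = op_A F x $ k $ j" for j k
  proof -
    \<comment> \<open>Exchanging \<open>j\<close> and \<open>k\<close> exchanges the two summands of
      the first double sum, up to the symmetry of \<open>F\<close>.\<close>
    have e1: "Q i i j l k l + Q i i k l l j = Q i i k l j l + Q i i j l l k" for i l
      using Qs[of i i j l k l] Qs[of i i k l j l] by simp
    have e2: "Q i i l l j k = Q i i l l k j" "Q i l j k i l = Q i l k j i l" for i l
      by (rule Qs, rule sw(3))
    show ?thesis
      unfolding A[of j k] e1 e2 unfolding A[of k j] by auto
  qed
  then have sym: "transpose (op_A F x) = op_A F x"
    by (simp add: vec_eq_iff transpose_def)
  \<comment> \<open>\<open>K\<close> is the Laplacian of the double divergence. In the trace, both
    halves of the first sum and the third sum contract to \<open>K\<close>, the second sum vanishes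
    since \<open>F\<close> is trace-free, and the Kronecker term contributes once for each of the
    \<open>n\<close> diagonal entries.\<close>
  define K where "K = (\<Sum>i\<in>UNIV. \<Sum>l\<in>UNIV. \<Sum>m\<in>UNIV. Q i i l m l m)"
  have K1: "(\<Sum>j\<in>UNIV. \<Sum>i\<in>UNIV. \<Sum>l\<in>UNIV. Q i i j l j l) = K"
    unfolding K_def by (rule sum.swap)
  have K4: "Q i i j l l j = Q i i j l j l" for i j l
    by (rule Qs)
  have K2: "(\<Sum>j\<in>UNIV. \<Sum>i\<in>UNIV. \<Sum>l\<in>UNIV. Q i l j j i l) = K"
    unfolding K_def
  proof (intro sum.cong refl)
    fix j i l
    \<comment> \<open>The contracted index \<open>j\<close> takes the place of the Laplacian index
      in \<open>K\<close>.\<close>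
    show "Q i l j j i l = Q j j i l i l" by (simp add: sw)
  qed
  have K3: "(\<Sum>j\<in>UNIV. \<Sum>i\<in>UNIV. \<Sum>l\<in>UNIV. Q i i l l j j) = 0"
  proof -
    have "(\<Sum>j\<in>UNIV. \<Sum>i\<in>UNIV. \<Sum>l\<in>UNIV. Q i i l l j j) =
        (\<Sum>i\<in>UNIV. \<Sum>j\<in>UNIV. \<Sum>l\<in>UNIV. Q i i l l j j)" by (rule sum.swap)
    also have "\<dots> = (\<Sum>i\<in>UNIV. \<Sum>l\<in>UNIV. \<Sum>j\<in>UNIV. Q i i l l j j)"
      by (intro sum.cong refl sum.swap)
    finally show ?thesis by (simp add: Qt)
  qed
  have "trace (op_A F x) = K + K - 0
      - (real CARD('n) - 2) / (real CARD('n) - 1) * K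
      - (\<Sum>j\<in>(UNIV::'n set). 1 / (real CARD('n) - 1) * K)"
    unfolding trace_def A K_def[symmetric] K4
    by (simp only: sum_subtractf sum.distrib sum_distrib_left[symmetric] K1 K2 K3) simp
  also have "\<dots> = 0"
    using n by (simp add: field_simps)
  finally show ?thesis using sym by (simp add: sym0_def)
qed

section \<open>The trace-free symmetric gradient and its annihilation by \<open>op_A\<close>\<close>

text \<open>The right-hand side is a linear combination of first derivatives with constant
  coefficients, the Kronecker delta included, so that linearity of \<open>pd4\<close> applies to it
  directly.\<close>

lemma dev_sym_grad_nth:
  fixes u :: "real^'n \<Rightarrow> real^'n"
  assumes S: "open S" and u: "u \<in> Cinf S UNIV" and x: "x \<in> S"
  shows "dev_sym_grad u x $ k $ l =
    1/2 * (pd l (\<lambda>y. u y $ k) x + pd k (\<lambda>y. u y $ l) x)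
      + (if k = l then - (1 / real CARD('n)) else 0) * (\<Sum>m\<in>UNIV. pd m (\<lambda>y. u y $ m) x)"
proof -
  have "(u has_derivative frechet_derivative u (at x)) (at x)"
    using u x Cinf_derivative_iff frechet_derivative_works by blast
  from bounded_linear.has_derivative[OF bounded_linear_vec_nth this]
  have "frechet_derivative (\<lambda>y. u y $ i) (at x) v = frechet_derivative u (at x) v $ i" for i v
    by (metis frechet_derivative_at)
  then have "jacobian u (at x) $ i $ j = pd j (\<lambda>y. u y $ i) x" for i j
    using pd_eq_frechet_derivative[OF Cinf_nth[OF S u] x]
    by (simp add: jacobian_def matrix_def)
  then show ?thesis
    by (auto simp: dev_sym_grad_def divergence_def transpose_def mat_def)
qed

lemma dev_sym_grad_Cinf:
  fixes u :: "real^'n \<Rightarrow> real^'n"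
  assumes S: "open S" and u: "u \<in> Cinf S UNIV"
  shows "dev_sym_grad u \<in> Cinf S sym0"
proof -
  have D: "pd i (\<lambda>y. u y $ j) \<in> Cinf S UNIV" for i j
    by (intro Cinf_pd Cinf_nth S u)
  have "dev_sym_grad u \<in> Cinf S UNIV"
  proof (intro Cinf_vecI[OF S])
    fix k l
    show "(\<lambda>x. dev_sym_grad u x $ k $ l) \<in> Cinf S UNIV"
      by (rule Cinf_cong[OF S dev_sym_grad_nth[OF S u, symmetric]])
        (assumption, intro Cinf_add Cinf_cmult Cinf_sum S D)
  qed
  \<comment> \<open>For the trace, the diagonal of the symmetric gradient sums to the divergence,
    and \<open>n\<close> corrections of \<open>- (1 / n)\<close> times the divergence cancel
    it.\<close>
  moreover have "dev_sym_grad u x \<in> sym0" if "x \<in> S" for x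
    using dev_sym_grad_nth[OF S u that]
    by (simp add: sym0_def vec_eq_iff transpose_def trace_def add.commute sum_subtractf)
  ultimately show ?thesis by (simp add: Cinf_iff[of "dev_sym_grad u" S sym0])
qed

lemma op_A_dev_sym_grad:
  fixes u :: "real^'n \<Rightarrow> real^'n"
  assumes n: "CARD('n) \<ge> 2" and S: "open S" and u: "u \<in> Cinf S UNIV" and x: "x \<in> S"
  shows "op_A (dev_sym_grad u) x = 0"
proof -
  define N where "N = real CARD('n)"
  have N: "N \<ge> 2" using n by (simp add: N_def)
  \<comment> \<open>The first five indices of \<open>P\<close> are derivatives and commute freely by
    \<open>sw\<close>; only the last one is a component of \<open>u\<close>.\<close>
  define P where "P a b c d m q = pd4 a b c d (pd m (\<lambda>y. u y $ q)) x" for a b c d m q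
  have U: "(\<lambda>y. u y $ q) \<in> Cinf S UNIV" for q by (intro Cinf_nth S u)
  note D = Cinf_pd[OF S U]
  note sw = pd4_swap[OF S D x, folded P_def] pd4_pd_swap[OF S U x, folded P_def]
  define T where "T a b c d k l = pd4 a b c d (\<lambda>y. dev_sym_grad u y $ k $ l) x" for a b c d k l
  have T: "T a b c d k l = 1/2 * (P a b c d l k + P a b c d k l)
      + (if k = l then - (1 / N) else 0) * (\<Sum>m\<in>UNIV. P a b c d m m)" for a b c d k l
    unfolding T_def P_def N_def
    by (subst pd4_cong[OF S dev_sym_grad_nth[OF S u] x], assumption)
      (simp only: pd4_add[OF S _ _ x] pd4_cmult[OF S _ x] pd4_sum[OF S _ x]
        Cinf_add Cinf_cmult Cinf_sum S D)
  define H where "H a b = (\<Sum>i\<in>UNIV. \<Sum>l\<in>UNIV. P i i l l a b)" for a b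
  define G where "G a b = (\<Sum>i\<in>UNIV. \<Sum>l\<in>UNIV. P i i a b l l)" for a b
  define K where "K = (\<Sum>i\<in>UNIV. \<Sum>l\<in>UNIV. \<Sum>m\<in>UNIV. P i i l l m m)"
  have delta: "(\<Sum>l\<in>UNIV. (if k = l then c else 0) * f l) = c * f k" for k c and f :: "'n \<Rightarrow> real"
    by (simp add: if_distrib[of "\<lambda>z. z * _"] cong: if_cong)
  note sums = sum.distrib sum_distrib_left[symmetric] delta
  \<comment> \<open>If \<open>l\<close> is also the component index, the contraction is a divergence
    and gives \<open>G\<close>; if it is a repeated derivative, it is a Laplacian and gives
    \<open>H\<close>. The delta part forces \<open>l = k\<close> and leaves \<open>G\<close>
    again.\<close>
  have S1: "(\<Sum>i\<in>UNIV. \<Sum>l\<in>UNIV. T i i j l k l) = 1/2 * (H j k + G j k) - 1/N * G j k" for j k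
  proof -
    have "P i i j l l k = P i i l l j k" "P i i j l k l = P i i j k l l" for i l
      by (simp_all add: sw)
    then show ?thesis by (simp only: T sums H_def G_def)
  qed
  have S2: "(\<Sum>i\<in>UNIV. \<Sum>l\<in>UNIV. T i i l l j k) =
      1/2 * (H k j + H j k) + (if j = k then - (1/N) else 0) * K" for j k
    by (simp only: T sums H_def K_def)
  have S3: "(\<Sum>i\<in>UNIV. \<Sum>l\<in>UNIV. T i l j k i l) = G j k - 1/N * G j k" for j k
  proof -
    have e: "P i l j k l i = P l l j k i i" "P i l j k i l = P i i j k l l" for i l
      by (simp_all add: sw)
    have "(\<Sum>i\<in>UNIV. \<Sum>l\<in>UNIV. P i l j k l i) = (\<Sum>i\<in>UNIV. \<Sum>l\<in>UNIV. P l l j k i i)"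
      by (intro sum.cong refl e)
    also have "\<dots> = G j k"
      unfolding G_def by (rule sum.swap)
    finally have 1: "(\<Sum>i\<in>UNIV. \<Sum>l\<in>UNIV. P i l j k l i) = G j k" .
    have 2: "(\<Sum>i\<in>UNIV. \<Sum>l\<in>UNIV. P i l j k i l) = G j k"
      unfolding G_def by (intro sum.cong refl e)
    have 3: "(\<Sum>i\<in>UNIV. \<Sum>m\<in>UNIV. P i i j k m m) = G j k"
      by (simp add: G_def)
    show ?thesis by (simp only: T sums 1 2 3) simp
  qed
  have S4: "(\<Sum>i\<in>UNIV. \<Sum>l\<in>UNIV. \<Sum>m\<in>UNIV. T i i l m l m) = K - 1/N * K"
  proof -
    have e: "P i i l m m l = P i i m m l l" "P i i l m l m = P i i l l m m" for i l m
      by (simp_all add: sw)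
    have "(\<Sum>i\<in>UNIV. \<Sum>l\<in>UNIV. \<Sum>m\<in>UNIV. P i i l m m l) =
        (\<Sum>i\<in>UNIV. \<Sum>l\<in>UNIV. \<Sum>m\<in>UNIV. P i i m m l l)"
      by (intro sum.cong refl e)
    also have "\<dots> = K"
      unfolding K_def by (intro sum.cong refl sum.swap)
    finally have 1: "(\<Sum>i\<in>UNIV. \<Sum>l\<in>UNIV. \<Sum>m\<in>UNIV. P i i l m m l) = K" .
    have 2: "(\<Sum>i\<in>UNIV. \<Sum>l\<in>UNIV. \<Sum>m\<in>UNIV. P i i l m l m) = K"
      unfolding K_def by (intro sum.cong refl e)
    have 3: "(\<Sum>i\<in>UNIV. \<Sum>l\<in>UNIV. \<Sum>m\<in>UNIV. P i i l l m m) = K"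
      by (simp add: K_def)
    show ?thesis by (simp only: T sums 1 2 3) simp
  qed
  \<comment> \<open>In the first sum of \<open>op_A\<close> the second half is the first with
    \<open>j\<close> and \<open>k\<close> exchanged, so \<open>S1\<close> is used for both orders
    and the two \<open>G\<close> terms must be merged.\<close>
  have Gs: "G k j = G j k" for j k
    unfolding G_def by (subst sw(3)) (rule refl)
  have Ts: "T a b c d k l = T a b c d l k" for a b c d k l
    by (simp add: T)
  have "op_A (dev_sym_grad u) x $ j $ k = 0" for j k
  proof -
    have "op_A (dev_sym_grad u) x $ j $ k =
       (\<Sum>i\<in>UNIV. \<Sum>l\<in>UNIV. T i i j l k l + T i i k l j l)
       - (\<Sum>i\<in>UNIV. \<Sum>l\<in>UNIV. T i i l l j k)
       - (N - 2) / (N - 1) * (\<Sum>i\<in>UNIV. \<Sum>l\<in>UNIV. T i l j k i l)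
       - (if j = k then 1 else 0) / (N - 1)
           * (\<Sum>i\<in>UNIV. \<Sum>l\<in>UNIV. \<Sum>m\<in>UNIV. T i i l m l m)"
      unfolding Ts[of _ _ k _ j] by (simp add: op_A_def T_def N_def)
    \<comment> \<open>The two \<open>H\<close> terms produced by \<open>S1\<close> cancel against
      those of \<open>S2\<close>; only \<open>G\<close> and \<open>K\<close> survive.\<close>
    also have "\<dots> = (1 - 2/N) * G j k - (if j = k then - (1/N) else 0) * K
        - (N - 2) / (N - 1) * (1 - 1/N) * G j k - (if j = k then 1 else 0) / (N - 1) * (1 - 1/N) * K"
      unfolding sum.distrib S1 S2 S3 S4 Gs[of k j] by (simp add: field_simps)
    also have "\<dots> = 0"
    proof -
      \<comment> \<open>Since \<open>1 - 1/N = (N - 1) / N\<close>, the factors \<open>N - 1\<close>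
        in the coefficients of \<open>op_A\<close> cancel; \<open>N \<ge> 2\<close> keeps both
        denominators nonzero.\<close>
      have "(N - 2) / (N - 1) * (1 - 1/N) = 1 - 2/N" "1 / (N - 1) * (1 - 1/N) = 1/N"
        using N by (auto simp: divide_simps algebra_simps)
      then show ?thesis
        by (cases "j = k") (simp_all only: if_True if_False, simp_all)
    qed
    finally show ?thesis .
  qed
  then show ?thesis by (simp add: vec_eq_iff)
qed

theorem proposition3p2:
  fixes \<Omega> :: "(real^'n) set"
  assumes "CARD('n) \<ge> 2"
    and "open \<Omega>"
  shows "(\<forall>F \<in> Cinf \<Omega> sym0. op_A F \<in> Cinf \<Omega> sym0) \<and>
    (\<forall>u :: real^'n \<Rightarrow> real^'n. u \<in> Cinf UNIV UNIV \<longrightarrow>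
       dev_sym_grad u \<in> Cinf \<Omega> sym0 \<and> (\<forall>x\<in>\<Omega>. op_A (dev_sym_grad u) x = 0))"
proof (intro conjI ballI allI impI)
  fix F :: "real^'n \<Rightarrow> real^'n^'n"
  assume F: "F \<in> Cinf \<Omega> sym0"
  then show "op_A F \<in> Cinf \<Omega> sym0"
    using op_A_smooth[OF assms(2), of F] op_A_sym0[OF assms F]
    by (simp add: Cinf_iff[of _ \<Omega> sym0])
next
  fix u :: "real^'n \<Rightarrow> real^'n"
  assume "u \<in> Cinf UNIV UNIV"
  then have u: "u \<in> Cinf \<Omega> UNIV" by (rule Cinf_subset) simp
  show "dev_sym_grad u \<in> Cinf \<Omega> sym0"
    by (rule dev_sym_grad_Cinf[OF assms(2) u])
  show "op_A (dev_sym_grad u) x = 0" if "x \<in> \<Omega>" for x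
    by (rule op_A_dev_sym_grad[OF assms u that])
qed

end
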